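(* Let $G$ be a connected graph with $n$ vertices and $e$ edges. Then $G$ can be decomposed into at most $\left\lfloor \frac{e+2}{2} \right\rfloor$ pairwise edge-disjoint paths; that is, there is a collection of at most $\left\lfloor \frac{e+2}{2} \right\rfloor$ paths in $G$ such that every edge of $G$ belongs to exactly one of them.
   Context: All graphs are finite, simple and undirected. A path is a sequence of distinct vertices in which consecutive vertices are adjacent. *)

theory Defs
  imports Main
begin

text \<open>Edges are unordered pairs, given as two-element sets of vertices.\<close>

definition simple_graph :: "'a set \<Rightarrow> 'a set set \<Rightarrow> bool" where
  "simple_graph V E \<longleftrightarrow> finite V \<and> (\<forall>e\<in>E. e \<subseteq> V \<and> card e = 2)"

text \<open>One-vertex paths are allowed, the empty list is not.\<close>

definition is_path :: "'a set \<Rightarrow> 'a set set \<Rightarrow> 'a list \<Rightarrow> bool" where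
  "is_path V E p \<longleftrightarrow>
     p \<noteq> [] \<and> distinct p \<and> set p \<subseteq> V \<and> successively (\<lambda>u v. {u, v} \<in> E) p"

definition path_edges :: "'a list \<Rightarrow> 'a set set" where
  "path_edges p = {{p ! i, p ! Suc i} | i. Suc i < length p}"

definition connected_graph :: "'a set \<Rightarrow> 'a set set \<Rightarrow> bool" where
  "connected_graph V E \<longleftrightarrow>
     simple_graph V E \<and> V \<noteq> {} \<and>
     (\<forall>u\<in>V. \<forall>v\<in>V. \<exists>p. is_path V E p \<and> hd p = u \<and> last p = v)"

text \<open>
  The condition \<open>\<exists>!\<close> comprises both that the paths cover \<open>E\<close> and that distinct members
  of the collection have no common edge.
\<close>

definition path_decomposition :: "'a set \<Rightarrow> 'a set set \<Rightarrow> 'a list set \<Rightarrow> bool" where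
  "path_decomposition V E P \<longleftrightarrow>
     finite P \<and> (\<forall>p\<in>P. is_path V E p) \<and> (\<forall>e\<in>E. \<exists>!p. p \<in> P \<and> e \<in> path_edges p)"

end

theory Submission
  imports Defs
begin

text \<open>
  The paths can be taken to have at most two edges. Assign every edge to one of its two
  endpoints, and call the set of edges assigned to a vertex its fibre. The edges of a fibre
  share a vertex, so any two of them form a path with two edges, and a fibre with \<open>k\<close> edges
  splits into \<open>k div 2\<close> such paths, plus one single edge if \<open>k\<close> is odd
  (\<open>star_decomposition\<close>). Summed over all vertices, twice the number of paths is at most the
  number of edges plus the number of odd fibres (\<open>assignment_decomposition\<close>).

  It remains to find an assignment with at most one odd fibre, and this is where connectedness
  enters. Moving one edge to its other endpoint changes the parity of the fibres at precisely
  its two endpoints. Doing this successively for the edges of a path from \<open>u\<close> to \<open>v\<close> changes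
  the parity at \<open>u\<close> and at \<open>v\<close> only, since every inner vertex is affected twice
  (\<open>flip_walk\<close>). Hence two odd fibres can always be made even simultaneously, and an assignment
  with the least number of odd fibres has at most one (\<open>at_most_one_odd_fibre\<close>). This gives
  \<open>(e + 1) div 2\<close> paths.
\<close>

section \<open>Decompositions of edge sets\<close>

text \<open>
  Confining the edges of the paths to \<open>F\<close> is what makes decompositions of disjoint edge
  sets combine; the paths still live in the whole graph.
\<close>

definition decomposes :: "'a set \<Rightarrow> 'a set set \<Rightarrow> 'a set set \<Rightarrow> 'a list set \<Rightarrow> bool" where
  "decomposes V E F P \<longleftrightarrow>
     finite P \<and> (\<forall>p\<in>P. is_path V E p \<and> path_edges p \<subseteq> F) \<and>
     (\<forall>e\<in>F. \<exists>!p. p \<in> P \<and> e \<in> path_edges p)"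

lemma simple_graph_finite_edges:
  assumes "simple_graph V E"
  shows "finite E"
proof -
  have "E \<subseteq> Pow V" "finite V" using assms by (auto simp: simple_graph_def)
  then show ?thesis by (meson finite_Pow_iff finite_subset)
qed

lemma decomposes_empty: "decomposes V E {} {}"
  by (simp add: decomposes_def)

lemma decomposes_path:
  assumes "is_path V E p"
  shows "decomposes V E (path_edges p) {p}"
  using assms by (auto simp: decomposes_def)

lemma decomposes_Un:
  assumes "decomposes V E F P" "decomposes V E G Q" "F \<inter> G = {}"
  shows "decomposes V E (F \<union> G) (P \<union> Q)"
proof -
  have inF: "\<exists>!p. p \<in> P \<union> Q \<and> e \<in> path_edges p" if "e \<in> F" for e
  proof -
    have "\<exists>!p. p \<in> P \<and> e \<in> path_edges p" using assms(1) that by (auto simp: decomposes_def)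
    moreover have "e \<notin> path_edges q" if "q \<in> Q" for q
      using assms(2,3) \<open>e \<in> F\<close> that unfolding decomposes_def by blast
    ultimately show ?thesis by blast
  qed
  have inG: "\<exists>!p. p \<in> P \<union> Q \<and> e \<in> path_edges p" if "e \<in> G" for e
  proof -
    have "\<exists>!p. p \<in> Q \<and> e \<in> path_edges p" using assms(2) that by (auto simp: decomposes_def)
    moreover have "e \<notin> path_edges q" if "q \<in> P" for q
      using assms(1,3) \<open>e \<in> G\<close> that unfolding decomposes_def by blast
    ultimately show ?thesis by blast
  qed
  have "\<forall>e\<in>F \<union> G. \<exists>!p. p \<in> P \<union> Q \<and> e \<in> path_edges p"
    by (intro ballI, elim UnE) (erule inF, erule inG)
  moreover have "finite (P \<union> Q)" "\<forall>p\<in>P \<union> Q. is_path V E p \<and> path_edges p \<subseteq> F \<union> G"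
    using assms(1,2) by (auto simp: decomposes_def)
  ultimately show ?thesis by (simp only: decomposes_def)
qed

lemma path_edges_2: "path_edges [a, b] = {{a, b}}"
  by (auto simp: path_edges_def)

lemma path_edges_3: "path_edges [a, v, b] = {{a, v}, {v, b}}"
proof -
  have "{i. Suc i < length [a, v, b]} = {0, 1}" by auto
  then have "path_edges [a, v, b] = (\<lambda>i. {[a, v, b] ! i, [a, v, b] ! Suc i}) ` {0, 1}"
    unfolding path_edges_def by blast
  then show ?thesis by simp
qed

lemma edge_other_end:
  assumes "simple_graph V E" "e \<in> E" "v \<in> e"
  obtains w where "e = {v, w}" "w \<noteq> v" "v \<in> V" "w \<in> V"
proof -
  have "card e = 2" "e \<subseteq> V" using assms by (auto simp: simple_graph_def)
  then obtain x y where "e = {x, y}" "x \<noteq> y" by (meson card_2_iff)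
  with assms(3) \<open>e \<subseteq> V\<close> show ?thesis using that by auto
qed

text \<open>
  Two distinct edges at \<open>v\<close> have distinct other ends, so together they are a path; edges are
  removed in pairs until at most one is left.
\<close>

lemma star_decomposition:
  assumes "simple_graph V E" "F \<subseteq> E" "\<forall>e\<in>F. v \<in> e"
  shows "\<exists>P. decomposes V E F P \<and> 2 * card P \<le> card F + of_bool (odd (card F))"
  using assms(2,3)
proof (induction "card F" arbitrary: F rule: less_induct)
  case less
  have fin: "finite F"
    using less.prems simple_graph_finite_edges[OF assms(1)] by (meson finite_subset)
  consider "F = {}" | e where "F = {e}" | e1 e2 where "e1 \<in> F" "e2 \<in> F" "e1 \<noteq> e2"
    by blast
  then show ?case
  proof cases
    case 1
    then show ?thesis using decomposes_empty by fastforce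
  next
    case (2 e)
    then have "e \<in> E" "v \<in> e" using less.prems by auto
    then obtain w where w: "e = {v, w}" "w \<noteq> v" "v \<in> V" "w \<in> V"
      using edge_other_end[OF assms(1)] by blast
    then have "is_path V E [v, w]" using \<open>e \<in> E\<close> by (auto simp: is_path_def)
    then have "decomposes V E F {[v, w]}"
      using decomposes_path[of V E "[v, w]"] by (simp add: path_edges_2 2 w(1))
    then show ?thesis using 2 by (intro exI[of _ "{[v, w]}"]) simp
  next
    case (3 e1 e2)
    have "e1 \<in> E" "e2 \<in> E" "v \<in> e1" "v \<in> e2" using 3 less.prems by auto
    then obtain a b where a: "e1 = {v, a}" "a \<noteq> v" "v \<in> V" "a \<in> V"
      and b: "e2 = {v, b}" "b \<noteq> v" "b \<in> V"
      using edge_other_end[OF assms(1)] by metis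
    let ?q = "[a, v, b]"
    have "{a, v} \<in> E" using a \<open>e1 \<in> E\<close> by (simp add: insert_commute)
    then have "is_path V E ?q" using a b 3 \<open>e2 \<in> E\<close> by (auto simp: is_path_def)
    moreover have "path_edges ?q = {e1, e2}"
      by (simp add: path_edges_3 a(1) b(1) insert_commute)
    ultimately have q: "decomposes V E {e1, e2} {?q}" using decomposes_path by metis
    let ?G = "F - {e1, e2}"
    have card: "card F = card ?G + 2"
    proof -
      have "card {e1, e2} = 2" "{e1, e2} \<subseteq> F" using 3 by auto
      then show ?thesis using fin by (metis card_Diff_subset card_mono finite_subset le_add_diff_inverse2)
    qed
    then obtain P where P: "decomposes V E ?G P"
      "2 * card P \<le> card ?G + of_bool (odd (card ?G))"
      using less.hyps[of ?G] less.prems by auto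
    have "decomposes V E ({e1, e2} \<union> ?G) ({?q} \<union> P)"
      using q P(1) by (rule decomposes_Un) blast
    moreover have "{e1, e2} \<union> ?G = F" using 3 by blast
    moreover have "card ({?q} \<union> P) \<le> card P + 1" using card_Un_le[of "{?q}" P] by simp
    ultimately show ?thesis using P(2) card by (intro exI[of _ "{?q} \<union> P"]) auto
  qed
qed

section \<open>Assigning edges to endpoints\<close>

definition fibre :: "'a set set \<Rightarrow> ('a set \<Rightarrow> 'a) \<Rightarrow> 'a \<Rightarrow> 'a set set" where
  "fibre E f x = {e \<in> E. f e = x}"

lemma assignment_decomposition:
  assumes "simple_graph V E" "\<forall>e\<in>E. f e \<in> e"
  shows "\<exists>P. decomposes V E E P \<and> 2 * card P \<le> card E + card {v \<in> V. odd (card (fibre E f v))}"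
proof -
  have claim: "\<exists>P. decomposes V E {e \<in> E. f e \<in> W} P \<and>
          2 * card P \<le> card {e \<in> E. f e \<in> W} + card {v \<in> W. odd (card (fibre E f v))}"
    if "finite W" for W
    using that
  proof (induction W rule: finite_induct)
    case empty
    then show ?case using decomposes_empty by fastforce
  next
    case (insert v W)
    then obtain P where P: "decomposes V E {e \<in> E. f e \<in> W} P"
      "2 * card P \<le> card {e \<in> E. f e \<in> W} + card {v \<in> W. odd (card (fibre E f v))}"
      by blast
    obtain Q where Q: "decomposes V E (fibre E f v) Q"
      "2 * card Q \<le> card (fibre E f v) + of_bool (odd (card (fibre E f v)))"
      using star_decomposition[OF assms(1), of "fibre E f v" v] assms(2)
      by (auto simp: fibre_def)
    have disj: "fibre E f v \<inter> {e \<in> E. f e \<in> W} = {}" using insert.hyps by (auto simp: fibre_def)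
    have un: "{e \<in> E. f e \<in> insert v W} = fibre E f v \<union> {e \<in> E. f e \<in> W}"
      by (auto simp: fibre_def)
    have "finite E" using assms(1) by (rule simple_graph_finite_edges)
    then have edges: "card {e \<in> E. f e \<in> insert v W} =
        card (fibre E f v) + card {e \<in> E. f e \<in> W}"
      unfolding un using disj by (intro card_Un_disjoint) (auto simp: fibre_def)
    have odds: "card {x \<in> insert v W. odd (card (fibre E f x))} =
        of_bool (odd (card (fibre E f v))) + card {x \<in> W. odd (card (fibre E f x))}"
    proof (cases "odd (card (fibre E f v))")
      case True
      then have "{x \<in> insert v W. odd (card (fibre E f x))} =
          insert v {x \<in> W. odd (card (fibre E f x))}" by auto
      then show ?thesis using True insert.hyps by simp
    next
      case False
      then have "{x \<in> insert v W. odd (card (fibre E f x))} =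
          {x \<in> W. odd (card (fibre E f x))}" by auto
      then show ?thesis using False by simp
    qed
    have "decomposes V E {e \<in> E. f e \<in> insert v W} (Q \<union> P)"
      unfolding un using Q(1) P(1) disj by (rule decomposes_Un)
    moreover have "2 * card (Q \<union> P) \<le> card {e \<in> E. f e \<in> insert v W} +
        card {x \<in> insert v W. odd (card (fibre E f x))}"
      using card_Un_le[of Q P] P(2) Q(2) edges odds by linarith
    ultimately show ?case by blast
  qed
  have "{e \<in> E. f e \<in> V} = E" "finite V" using assms by (auto simp: simple_graph_def)
  then show ?thesis using claim[of V] by simp
qed

section \<open>Parity of the fibres\<close>

lemma flip_edge:
  assumes "finite E" "\<forall>e\<in>E. f e \<in> e" "{a, b} \<in> E" "a \<noteq> b"
  shows "\<exists>g. (\<forall>e\<in>E. g e \<in> e) \<and>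
           (\<forall>x. odd (card (fibre E g x)) \<longleftrightarrow> (odd (card (fibre E f x)) \<noteq> ((x = a) \<noteq> (x = b))))"
proof -
  have move: "\<exists>g. (\<forall>e\<in>E. g e \<in> e) \<and>
      (\<forall>x. odd (card (fibre E g x)) \<longleftrightarrow> (odd (card (fibre E f x)) \<noteq> ((x = c) \<noteq> (x = d))))"
    if cd: "{c, d} \<in> E" "c \<noteq> d" "f {c, d} = c" for c d
  proof -
    let ?g = "f({c, d} := d)"
    have fin: "finite (fibre E f x)" for x using assms(1) by (simp add: fibre_def)
    have "fibre E f c = insert {c, d} (fibre E ?g c)" "{c, d} \<notin> fibre E ?g c"
      "fibre E ?g d = insert {c, d} (fibre E f d)" "{c, d} \<notin> fibre E f d"
      using cd by (auto simp: fibre_def)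
    then have "card (fibre E f c) = Suc (card (fibre E ?g c))"
      "card (fibre E ?g d) = Suc (card (fibre E f d))"
      using fin by (metis card_insert_disjoint finite_insert)+
    moreover have "fibre E ?g x = fibre E f x" if "x \<noteq> c" "x \<noteq> d" for x
      using cd that by (auto simp: fibre_def)
    ultimately have "odd (card (fibre E ?g x)) \<longleftrightarrow>
        (odd (card (fibre E f x)) \<noteq> ((x = c) \<noteq> (x = d)))" for x
      using cd(2) by (cases "x = c"; cases "x = d") auto
    moreover have "\<forall>e\<in>E. ?g e \<in> e" using assms(2) by auto
    ultimately show ?thesis by blast
  qed
  have "f {a, b} = a \<or> f {a, b} = b" using assms(2,3) by blast
  then show ?thesis
  proof
    assume "f {a, b} = a"
    then show ?thesis using move[of a b] assms by blast
  next
    assume "f {a, b} = b"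
    then have "\<exists>g. (\<forall>e\<in>E. g e \<in> e) \<and>
      (\<forall>x. odd (card (fibre E g x)) \<longleftrightarrow> (odd (card (fibre E f x)) \<noteq> ((x = b) \<noteq> (x = a))))"
      using move[of b a] assms by (simp add: insert_commute)
    then show ?thesis by (simp only: eq_commute[of "_ = b" "_ = a"])
  qed
qed

text \<open>
  Induction along the walk: the parity changes at an inner vertex, caused by the two walk edges
  meeting there, cancel.
\<close>

lemma flip_walk:
  assumes "simple_graph V E" "p \<noteq> []" "successively (\<lambda>u v. {u, v} \<in> E) p" "\<forall>e\<in>E. f e \<in> e"
  shows "\<exists>g. (\<forall>e\<in>E. g e \<in> e) \<and>
           (\<forall>x. odd (card (fibre E g x)) \<longleftrightarrow>
             (odd (card (fibre E f x)) \<noteq> ((x = hd p) \<noteq> (x = last p))))"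
  using assms(2-4)
proof (induction p arbitrary: f rule: induct_list012)
  case 1
  then show ?case by simp
next
  case (2 u)
  then show ?case by (intro exI[of _ f]) simp
next
  case (3 u w p)
  have "{u, w} \<in> E" using 3 by simp
  moreover from this have "u \<noteq> w" using assms(1) by (auto simp: simple_graph_def)
  ultimately obtain h where h: "\<forall>e\<in>E. h e \<in> e"
    "\<And>x. odd (card (fibre E h x)) \<longleftrightarrow> (odd (card (fibre E f x)) \<noteq> ((x = u) \<noteq> (x = w)))"
    using flip_edge[OF simple_graph_finite_edges[OF assms(1)]] "3.prems"(3) by metis
  obtain g where g: "\<forall>e\<in>E. g e \<in> e"
    "\<And>x. odd (card (fibre E g x)) \<longleftrightarrow>
      (odd (card (fibre E h x)) \<noteq> ((x = w) \<noteq> (x = last (w # p))))"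
    using "3.IH"(2)[of h] "3.prems" h(1) by auto
  have "odd (card (fibre E g x)) \<longleftrightarrow>
      (odd (card (fibre E f x)) \<noteq> ((x = hd (u # w # p)) \<noteq> (x = last (u # w # p))))" for x
    unfolding g(2) h(2) list.sel last_ConsR[OF list.distinct(2), of u w p] by blast
  with g(1) show ?case by blast
qed

text \<open>
  In an assignment with the fewest odd fibres, two odd fibres could be made even along a path
  between their vertices, without affecting the parity of any other fibre.
\<close>

lemma at_most_one_odd_fibre:
  assumes "connected_graph V E"
  obtains f where "\<forall>e\<in>E. f e \<in> e" "card {v \<in> V. odd (card (fibre E f v))} \<le> 1"
proof -
  have graph: "simple_graph V E" using assms by (simp add: connected_graph_def)
  let ?odds = "\<lambda>f. {v \<in> V. odd (card (fibre E f v))}"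
  have fin: "finite (?odds f)" for f using graph by (simp add: simple_graph_def)
  have "\<forall>e\<in>E. (SOME v. v \<in> e) \<in> e"
  proof
    fix e assume "e \<in> E"
    then have "card e = 2" using graph by (simp add: simple_graph_def)
    then have "e \<noteq> {}" by auto
    then show "(SOME v. v \<in> e) \<in> e" by (simp add: some_in_eq)
  qed
  then obtain f where f: "\<forall>e\<in>E. f e \<in> e"
    and least: "\<And>g. \<forall>e\<in>E. g e \<in> e \<Longrightarrow> card (?odds f) \<le> card (?odds g)"
    using ex_has_least_nat[of "\<lambda>f. \<forall>e\<in>E. f e \<in> e" "\<lambda>e. SOME v. v \<in> e" "\<lambda>f. card (?odds f)"]
    by blast
  have "u = v" if u: "u \<in> ?odds f" and v: "v \<in> ?odds f" for u v
  proof (rule ccontr)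
    assume "u \<noteq> v"
    obtain p where p: "is_path V E p" "hd p = u" "last p = v"
      using assms u v unfolding connected_graph_def by blast
    then have walk: "p \<noteq> []" "successively (\<lambda>u v. {u, v} \<in> E) p"
      by (auto simp: is_path_def)
    obtain g where g: "\<forall>e\<in>E. g e \<in> e"
      "\<And>x. odd (card (fibre E g x)) \<longleftrightarrow> (odd (card (fibre E f x)) \<noteq> ((x = u) \<noteq> (x = v)))"
      using flip_walk[OF graph walk f] p by auto
    have "?odds g = ?odds f - {u, v}" using u v \<open>u \<noteq> v\<close> by (auto simp: g(2))
    then have "?odds g \<subset> ?odds f" using u by blast
    then have "card (?odds g) < card (?odds f)" using fin by (rule psubset_card_mono[rotated])
    with least[OF g(1)] show False by simp
  qed
  then have "card (?odds f) \<le> 1" using fin by (simp add: card_le_Suc0_iff_eq)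
  with f show ?thesis using that by blast
qed

theorem theorem3p1:
  fixes V :: "'a set" and E :: "'a set set" and n e :: nat
  assumes "connected_graph V E" and "card V = n" and "card E = e"
  shows "\<exists>P. path_decomposition V E P \<and> card P \<le> (e + 2) div 2"
proof -
  obtain f where f: "\<forall>e\<in>E. f e \<in> e" "card {v \<in> V. odd (card (fibre E f v))} \<le> 1"
    using at_most_one_odd_fibre[OF assms(1)] .
  have "simple_graph V E" using assms(1) by (simp add: connected_graph_def)
  then obtain P where P: "decomposes V E E P"
    "2 * card P \<le> card E + card {v \<in> V. odd (card (fibre E f v))}"
    using assignment_decomposition f(1) by blast
  have "path_decomposition V E P"
    using P(1) by (simp add: decomposes_def path_decomposition_def)
  moreover have "card P \<le> (e + 2) div 2" using P(2) f(2) assms(3) by linarith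
  ultimately show ?thesis by blast
qed

end
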